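(* Every finitely generated free quandle is Hopfian.
   Context: A quandle is a non-empty set $X$ with a binary operation $*$ such that: (1) $x*x=x$ for all $x\in X$; (2) for all $x,y\in X$ there is a unique $z\in X$ with $x=z*y$ (one writes $z=x*^{-1}y$); (3) $(x*y)*z=(x*z)*(y*z)$ for all $x,y,z\in X$. A quandle homomorphism is a map $f$ with $f(x*y)=f(x)*f(y)$. A quandle $X$ is finitely generated if there is a finite subset of $X$ such that the smallest subset containing it and closed under $*$ and $*^{-1}$ is $X$. A quandle $X$ is Hopfian if every surjective quandle endomorphism of $X$ is injective. A free quandle on a non-empty set $S$ is a quandle $FQ(S)$ together with a map $\phi:S\to FQ(S)$ such that for every quandle $X$ and every map $\rho:S\to X$ there is a unique quandle homomorphism $\bar\rho:FQ(S)\to X$ with $\bar\rho\circ\phi=\rho$. It is unique up to isomorphism. *)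

theory Defs
  imports Main "HOL-Library.FuncSet"
begin

locale quandle =
  fixes X :: "'a set" and op :: "'a \<Rightarrow> 'a \<Rightarrow> 'a"
  assumes nonempty: "X \<noteq> {}"
    and closed: "\<lbrakk>x \<in> X; y \<in> X\<rbrakk> \<Longrightarrow> op x y \<in> X"
    and idem: "x \<in> X \<Longrightarrow> op x x = x"
    and right_div: "\<lbrakk>x \<in> X; y \<in> X\<rbrakk> \<Longrightarrow> \<exists>!z. z \<in> X \<and> x = op z y"
    and distrib: "\<lbrakk>x \<in> X; y \<in> X; z \<in> X\<rbrakk> \<Longrightarrow> op (op x y) z = op (op x z) (op y z)"

definition quandle_inv_op :: "'a set \<Rightarrow> ('a \<Rightarrow> 'a \<Rightarrow> 'a) \<Rightarrow> 'a \<Rightarrow> 'a \<Rightarrow> 'a" where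
  "quandle_inv_op X op x y = (THE z. z \<in> X \<and> x = op z y)"

definition quandle_hom ::
    "'a set \<Rightarrow> ('a \<Rightarrow> 'a \<Rightarrow> 'a) \<Rightarrow> 'b set \<Rightarrow> ('b \<Rightarrow> 'b \<Rightarrow> 'b) \<Rightarrow> ('a \<Rightarrow> 'b) set" where
  "quandle_hom X op Y op' = {f \<in> X \<rightarrow> Y. \<forall>x\<in>X. \<forall>y\<in>X. f (op x y) = op' (f x) (f y)}"

definition quandle_span :: "'a set \<Rightarrow> ('a \<Rightarrow> 'a \<Rightarrow> 'a) \<Rightarrow> 'a set \<Rightarrow> 'a set" where
  "quandle_span X op A =
     \<Inter>{B. A \<subseteq> B \<and> B \<subseteq> X \<and> (\<forall>x\<in>B. \<forall>y\<in>B. op x y \<in> B \<and> quandle_inv_op X op x y \<in> B)}"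

definition finitely_generated_quandle :: "'a set \<Rightarrow> ('a \<Rightarrow> 'a \<Rightarrow> 'a) \<Rightarrow> bool" where
  "finitely_generated_quandle X op \<longleftrightarrow>
     quandle X op \<and> (\<exists>A. finite A \<and> A \<subseteq> X \<and> quandle_span X op A = X)"

definition hopfian_quandle :: "'a set \<Rightarrow> ('a \<Rightarrow> 'a \<Rightarrow> 'a) \<Rightarrow> bool" where
  "hopfian_quandle X op \<longleftrightarrow>
     quandle X op \<and> (\<forall>f \<in> quandle_hom X op X op. f ` X = X \<longrightarrow> inj_on f X)"

text \<open>The universal property of \<open>\<phi> : S \<rightarrow> F\<close>, tested against all quandles whose carrier is
  a set of elements of the type \<open>'x\<close>. Homomorphisms are made \<open>extensional\<close> so that uniqueness
  refers to their values on the carrier only.\<close>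

definition quandle_universal ::
    "'x itself \<Rightarrow> 'a set \<Rightarrow> ('a \<Rightarrow> 'a \<Rightarrow> 'a) \<Rightarrow> 's set \<Rightarrow> ('s \<Rightarrow> 'a) \<Rightarrow> bool" where
  "quandle_universal _ F op S \<phi> \<longleftrightarrow>
     (\<forall>(X :: 'x set) op' \<rho>. quandle X op' \<and> \<rho> \<in> S \<rightarrow> X \<longrightarrow>
        (\<exists>!h. h \<in> quandle_hom F op X op' \<and> h \<in> extensional F \<and> (\<forall>s\<in>S. h (\<phi> s) = \<rho> s)))"

text \<open>HOL cannot quantify over types inside a definition, so the quandles in the definition of a
  free quandle range over one type. It is chosen large enough to lose nothing: it contains a copy
  of the type of \<open>F\<close>, and, since every quandle generated by an image of \<open>S\<close> is a quotient of a
  set of terms over \<open>S\<close>, a copy of every such quandle. The theorem \<open>is_free_quandle_universal\<close>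
  below confirms that the universal property then holds for quandles of every type.\<close>

datatype 's qterm = Gen 's | Op "'s qterm" "'s qterm" | InvOp "'s qterm" "'s qterm"

definition is_free_quandle ::
    "'a set \<Rightarrow> ('a \<Rightarrow> 'a \<Rightarrow> 'a) \<Rightarrow> 's set \<Rightarrow> ('s \<Rightarrow> 'a) \<Rightarrow> bool" where
  "is_free_quandle F op S \<phi> \<longleftrightarrow>
     S \<noteq> {} \<and> quandle F op \<and> \<phi> \<in> S \<rightarrow> F \<and> quandle_universal TYPE('a + 's qterm) F op S \<phi>"

context quandle
begin

lemma inv_op:
  assumes "x \<in> X" "y \<in> X"
  shows "quandle_inv_op X op x y \<in> X" "op (quandle_inv_op X op x y) y = x"
  using theI'[OF right_div[OF assms]] unfolding quandle_inv_op_def by auto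

lemma inv_op_eqI: "\<lbrakk>z \<in> X; y \<in> X; op z y = x\<rbrakk> \<Longrightarrow> quandle_inv_op X op x y = z"
  using right_div[of x y] inv_op[of x y] closed by metis

lemma subquandle:
  assumes "B \<noteq> {}" "B \<subseteq> X" "\<And>x y. \<lbrakk>x \<in> B; y \<in> B\<rbrakk> \<Longrightarrow> op x y \<in> B"
    and "\<And>x y. \<lbrakk>x \<in> B; y \<in> B\<rbrakk> \<Longrightarrow> quandle_inv_op X op x y \<in> B"
  shows "quandle B op"
proof
  fix x y assume xy: "x \<in> B" "y \<in> B"
  then have xyX: "x \<in> X" "y \<in> X" using assms(2) by auto
  show "\<exists>!z. z \<in> B \<and> x = op z y"
  proof (rule ex1I[of _ "quandle_inv_op X op x y"])
    show "quandle_inv_op X op x y \<in> B \<and> x = op (quandle_inv_op X op x y) y"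
      using assms(4)[OF xy] inv_op(2)[OF xyX] by simp
    show "z = quandle_inv_op X op x y" if "z \<in> B \<and> x = op z y" for z
      using inv_op_eqI[of z y x, symmetric] that xyX assms(2) by blast
  qed
next
  show "op (op x y) z = op (op x z) (op y z)" if "x \<in> B" "y \<in> B" "z \<in> B" for x y z
    using distrib[of x y z] that assms(2) by blast
qed (use assms(1-3) idem in auto)

lemma transport:
  fixes i :: "'a \<Rightarrow> 'c"
  assumes i: "inj_on i X"
  defines "j \<equiv> the_inv_into X i"
  shows "quandle (i ` X) (\<lambda>u v. i (op (j u) (j v)))"
proof
  have j: "j (i x) = x" if "x \<in> X" for x
    using i that by (simp add: j_def the_inv_into_f_f)
  show "\<exists>!z. z \<in> i ` X \<and> u = i (op (j z) (j v))" if "u \<in> i ` X" "v \<in> i ` X" for u v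
  proof -
    obtain x y where xy: "x \<in> X" "y \<in> X" "u = i x" "v = i y" using \<open>u \<in> i ` X\<close> \<open>v \<in> i ` X\<close> by blast
    show ?thesis
    proof (rule ex1I[of _ "i (quandle_inv_op X op x y)"])
      show "i (quandle_inv_op X op x y) \<in> i ` X \<and> u = i (op (j (i (quandle_inv_op X op x y))) (j v))"
        using xy inv_op j by auto
      fix z assume z: "z \<in> i ` X \<and> u = i (op (j z) (j v))"
      then obtain w where w: "w \<in> X" "z = i w" by auto
      then have "x = op w y" using z xy j i closed by (auto dest: inj_onD)
      then show "z = i (quandle_inv_op X op x y)" using inv_op_eqI w xy by auto
    qed
  qed
  show "i (op (j (i (op (j x) (j y)))) (j z)) = i (op (j (i (op (j x) (j z)))) (j (i (op (j y) (j z)))))"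
    if "x \<in> i ` X" "y \<in> i ` X" "z \<in> i ` X" for x y z
  proof -
    obtain a b c where abc: "a \<in> X" "b \<in> X" "c \<in> X" "x = i a" "y = i b" "z = i c"
      using \<open>x \<in> i ` X\<close> \<open>y \<in> i ` X\<close> \<open>z \<in> i ` X\<close> by blast
    then show ?thesis using distrib[of a b c] by (simp only: j closed)
  qed
qed (use i nonempty closed idem in \<open>auto simp: j_def the_inv_into_f_f\<close>)

end

primrec qeval :: "'c set \<Rightarrow> ('c \<Rightarrow> 'c \<Rightarrow> 'c) \<Rightarrow> ('s \<Rightarrow> 'c) \<Rightarrow> 's qterm \<Rightarrow> 'c" where
  "qeval X op \<rho> (Gen s) = \<rho> s"
| "qeval X op \<rho> (Op t u) = op (qeval X op \<rho> t) (qeval X op \<rho> u)"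
| "qeval X op \<rho> (InvOp t u) = quandle_inv_op X op (qeval X op \<rho> t) (qeval X op \<rho> u)"

lemma quandle_homD:
  assumes "f \<in> quandle_hom X op Y op'"
  shows "x \<in> X \<Longrightarrow> f x \<in> Y" "\<lbrakk>x \<in> X; y \<in> X\<rbrakk> \<Longrightarrow> f (op x y) = op' (f x) (f y)"
  using assms by (auto simp: quandle_hom_def)

lemma quandle_hom_inv_op:
  assumes "quandle X op" "quandle Y op'" "f \<in> quandle_hom X op Y op'" "x \<in> X" "y \<in> X"
  shows "f (quandle_inv_op X op x y) = quandle_inv_op Y op' (f x) (f y)"
  using assms quandle.inv_op[OF assms(1,4,5)] quandle_homD[OF assms(3)]
  by (metis quandle.inv_op_eqI)

text \<open>The universal property for test quandles in a type passes to any test quandle that embeds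
  into that type.\<close>

lemma quandle_universal_transport:
  fixes i :: "'c \<Rightarrow> 'x"
  assumes U: "quandle_universal TYPE('x) F op S \<phi>" and F: "quandle F op" and phi: "\<phi> \<in> S \<rightarrow> F"
    and X: "quandle X op'" and i: "inj_on i X" and rho: "\<rho> \<in> S \<rightarrow> X"
  shows "\<exists>!h. h \<in> quandle_hom F op X op' \<and> h \<in> extensional F \<and> (\<forall>s\<in>S. h (\<phi> s) = \<rho> s)"
proof -
  interpret F: quandle F op by fact
  interpret X: quandle X op' by fact
  define j where "j = the_inv_into X i"
  have j: "j (i x) = x" if "x \<in> X" for x
    using i that by (simp add: j_def the_inv_into_f_f)
  let ?o = "\<lambda>u v. i (op' (j u) (j v))"
  have "quandle (i ` X) ?o" using X.transport[OF i] by (simp add: j_def)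
  moreover have "(\<lambda>s. i (\<rho> s)) \<in> S \<rightarrow> i ` X" using rho by auto
  ultimately have E: "\<exists>!h. h \<in> quandle_hom F op (i ` X) ?o \<and> h \<in> extensional F \<and> (\<forall>s\<in>S. h (\<phi> s) = i (\<rho> s))"
    using U unfolding quandle_universal_def by blast
  then obtain h where h: "h \<in> quandle_hom F op (i ` X) ?o" "\<forall>s\<in>S. h (\<phi> s) = i (\<rho> s)" by blast
  note hD = quandle_homD[OF h(1)]
  let ?k = "restrict (\<lambda>x. j (h x)) F"
  have jX: "j u \<in> X" if "u \<in> i ` X" for u using that j by auto
  have k: "?k \<in> quandle_hom F op X op'" "?k \<in> extensional F" "\<forall>s\<in>S. ?k (\<phi> s) = \<rho> s"
    using hD h(2) phi rho j jX F.closed X.closed by (auto simp: quandle_hom_def Pi_iff)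
  show ?thesis
  proof (rule ex1I[of _ ?k])
    show "?k \<in> quandle_hom F op X op' \<and> ?k \<in> extensional F \<and> (\<forall>s\<in>S. ?k (\<phi> s) = \<rho> s)"
      using k by blast
    fix l assume l: "l \<in> quandle_hom F op X op' \<and> l \<in> extensional F \<and> (\<forall>s\<in>S. l (\<phi> s) = \<rho> s)"
    have P: "restrict (i \<circ> m) F \<in> quandle_hom F op (i ` X) ?o \<and> restrict (i \<circ> m) F \<in> extensional F
        \<and> (\<forall>s\<in>S. restrict (i \<circ> m) F (\<phi> s) = i (\<rho> s))"
      if "m \<in> quandle_hom F op X op' \<and> m \<in> extensional F \<and> (\<forall>s\<in>S. m (\<phi> s) = \<rho> s)" for m
      using that phi F.closed by (auto simp: quandle_hom_def Pi_iff j)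
    have eq: "restrict (i \<circ> l) F = restrict (i \<circ> ?k) F"
      using E P[OF l] P[of ?k] k by blast
    show "l = ?k"
    proof (rule extensionalityI[of _ F])
      fix x assume x: "x \<in> F"
      then have "i (l x) = i (?k x)" using fun_cong[OF eq, of x] by simp
      moreover have "l x \<in> X" "?k x \<in> X"
        using l x quandle_homD(1)[of l, OF _ x] quandle_homD(1)[OF k(1) x] by blast+
      ultimately show "l x = ?k x" using i by (auto dest: inj_onD)
    qed (use l in auto)
  qed
qed

theorem is_free_quandle_universal:
  assumes "is_free_quandle F op S \<phi>"
  shows "quandle_universal TYPE('x) F op S \<phi>"
  unfolding quandle_universal_def
proof (intro allI impI)
  fix X :: "'x set" and op' \<rho>
  assume "quandle X op' \<and> \<rho> \<in> S \<rightarrow> X"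
  then have X: "quandle X op'" and rho: "\<rho> \<in> S \<rightarrow> X" by auto
  from assms have S: "S \<noteq> {}" and F: "quandle F op" and phi: "\<phi> \<in> S \<rightarrow> F"
    and U: "quandle_universal TYPE('a + 'b qterm) F op S \<phi>"
    by (auto simp: is_free_quandle_def)
  interpret F: quandle F op by fact
  interpret X: quandle X op' by fact
  define T where "T = {t :: 'b qterm. set_qterm t \<subseteq> S}"
  define B where "B = qeval X op' \<rho> ` T"
  have ev: "qeval X op' \<rho> t \<in> X" if "t \<in> T" for t
    using that rho by (induction t) (auto simp: T_def X.closed X.inv_op)
  have BX: "B \<subseteq> X" using ev by (auto simp: B_def)
  have rhoB: "\<rho> \<in> S \<rightarrow> B"
  proof
    fix s assume "s \<in> S"
    then have "Gen s \<in> T" by (simp add: T_def)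
    then show "\<rho> s \<in> B" unfolding B_def by (metis image_eqI qeval.simps(1))
  qed
  have B: "quandle B op'"
  proof (rule X.subquandle)
    show "B \<noteq> {}" using S rhoB by auto
    show "op' x y \<in> B" "quandle_inv_op X op' x y \<in> B" if "x \<in> B" "y \<in> B" for x y
    proof -
      obtain t u where tu: "t \<in> T" "u \<in> T" "x = qeval X op' \<rho> t" "y = qeval X op' \<rho> u"
        using \<open>x \<in> B\<close> \<open>y \<in> B\<close> by (auto simp: B_def)
      have "Op t u \<in> T" "InvOp t u \<in> T" using tu by (auto simp: T_def)
      then show "op' x y \<in> B" "quandle_inv_op X op' x y \<in> B"
        unfolding B_def tu by (metis image_eqI qeval.simps)+
    qed
  qed (fact BX)
  define i :: "'x \<Rightarrow> 'a + 'b qterm" where "i = Inr \<circ> inv_into T (qeval X op' \<rho>)"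
  have "inj_on i B"
    unfolding i_def B_def by (intro comp_inj_on inj_on_inv_into) auto
  from quandle_universal_transport[OF U F phi B this rhoB]
  obtain h where h: "h \<in> quandle_hom F op B op'" "h \<in> extensional F" "\<forall>s\<in>S. h (\<phi> s) = \<rho> s"
    by blast
  show "\<exists>!h. h \<in> quandle_hom F op X op' \<and> h \<in> extensional F \<and> (\<forall>s\<in>S. h (\<phi> s) = \<rho> s)"
  proof (rule ex1I[of _ h])
    show hX: "h \<in> quandle_hom F op X op' \<and> h \<in> extensional F \<and> (\<forall>s\<in>S. h (\<phi> s) = \<rho> s)"
      using h BX by (auto simp: quandle_hom_def)
    fix k assume k: "k \<in> quandle_hom F op X op' \<and> k \<in> extensional F \<and> (\<forall>s\<in>S. k (\<phi> s) = \<rho> s)"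
    define E where "E = {x \<in> F. k x = h x}"
    have phiE: "\<phi> \<in> S \<rightarrow> E" using phi k h by (auto simp: E_def)
    have E: "quandle E op"
    proof (rule F.subquandle)
      show "E \<noteq> {}" using S phiE by auto
      show "op x y \<in> E" if "x \<in> E" "y \<in> E" for x y
        using that F.closed k hX by (auto simp: E_def quandle_hom_def)
      show "quandle_inv_op F op x y \<in> E" if "x \<in> E" "y \<in> E" for x y
        using that k hX quandle_hom_inv_op[OF F X, of k x y] quandle_hom_inv_op[OF F X, of h x y]
          F.inv_op(1)[of x y] by (simp add: E_def)
    qed (auto simp: E_def)
    have inj: "inj_on (Inl :: 'a \<Rightarrow> 'a + 'b qterm) A" for A by simp
    from quandle_universal_transport[OF U F phi E inj phiE]
    obtain r where r: "r \<in> quandle_hom F op E op" "r \<in> extensional F" "\<forall>s\<in>S. r (\<phi> s) = \<phi> s"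
      by blast
    have "r \<in> quandle_hom F op F op" using r(1) by (auto simp: quandle_hom_def E_def)
    moreover have "restrict (\<lambda>x. x) F \<in> quandle_hom F op F op"
      using F.closed by (auto simp: quandle_hom_def)
    moreover have "\<forall>s\<in>S. restrict (\<lambda>x. x) F (\<phi> s) = \<phi> s" using phi by auto
    ultimately have "r = restrict (\<lambda>x. x) F"
      using quandle_universal_transport[OF U F phi F inj phi] r(2,3) restrict_extensional by blast
    then have "x \<in> E" if "x \<in> F" for x
      using that quandle_homD(1)[OF r(1) that] by simp
    then show "k = h"
      using k h(2) by (intro extensionalityI[of _ F]) (auto simp: E_def)
  qed
qed

end

theory Submission
  imports Defs "HOL-Combinatorics.Permutations"
begin

text \<open>By Mal'cev's argument, a finitely generated quandle whose points are separated by
  homomorphisms to finite quandles is Hopfian: for a surjective endomorphism \<open>f\<close> and a finite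
  quandle \<open>Q\<close>, precomposition with \<open>f\<close> is an injective, hence surjective, self-map of the finite
  set of homomorphisms to \<open>Q\<close>, so that every such homomorphism identifies whatever \<open>f\<close> identifies.

  To separate points of a free quandle \<open>F\<close>, let \<open>P \<subseteq> F\<close> be a finite set. The pairs \<open>(p, c)\<close> of a
  point \<open>p \<in> P\<close> and a permutation \<open>c\<close> of \<open>P\<close> fixing \<open>p\<close> form a finite quandle under
  \<open>(p, c) * (q, d) = (d p, d c d\<^sup>-\<^sup>1)\<close>. For every generator \<open>a \<in> P\<close>, the partial injection
  \<open>z \<mapsto> z * a\<close> of \<open>P\<close> extends to a permutation of \<open>P\<close>, which fixes \<open>a\<close>; this defines a
  homomorphism from \<open>F\<close>, and as soon as \<open>P\<close> is large enough, its first component maps a given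
  \<open>x \<in> F\<close> to \<open>x\<close> itself.\<close>

section \<open>Residually finite quandles\<close>

context quandle
begin

lemma inv_op_op: "\<lbrakk>x \<in> X; y \<in> X\<rbrakk> \<Longrightarrow> quandle_inv_op X op (op x y) y = x"
  by (rule inv_op_eqI) simp_all

lemma op_right_cancel: "\<lbrakk>x \<in> X; y \<in> X; z \<in> X; op x z = op y z\<rbrakk> \<Longrightarrow> x = y"
  using inv_op_op by metis

end

lemma quandle_span_least:
  assumes "A \<subseteq> B" "B \<subseteq> X" "\<And>x y. \<lbrakk>x \<in> B; y \<in> B\<rbrakk> \<Longrightarrow> op x y \<in> B"
    and "\<And>x y. \<lbrakk>x \<in> B; y \<in> B\<rbrakk> \<Longrightarrow> quandle_inv_op X op x y \<in> B"
  shows "quandle_span X op A \<subseteq> B"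
  unfolding quandle_span_def by (rule Inter_lower) (simp add: assms)

text \<open>The equalizer of \<open>f\<close> and \<open>g\<close> is closed under both operations,
  since homomorphisms also preserve \<open>quandle_inv_op\<close>.\<close>

lemma quandle_hom_eq_on_span:
  assumes X: "quandle X op" and Y: "quandle Y op'"
    and f: "f \<in> quandle_hom X op Y op'" and g: "g \<in> quandle_hom X op Y op'"
    and A: "A \<subseteq> X" and eq: "\<And>a. a \<in> A \<Longrightarrow> f a = g a" and x: "x \<in> quandle_span X op A"
  shows "f x = g x"
proof -
  interpret X: quandle X op by fact
  have "quandle_span X op A \<subseteq> {x \<in> X. f x = g x}"
    using A eq X.closed X.inv_op(1) quandle_homD(2)[OF f] quandle_homD(2)[OF g]
      quandle_hom_inv_op[OF X Y f] quandle_hom_inv_op[OF X Y g]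
    by (intro quandle_span_least) auto
  then show ?thesis using x by blast
qed

text \<open>Restriction to a finite generating set is injective on homomorphisms and takes finitely
  many values. Intersecting with \<open>extensional X\<close> removes the freedom outside
  \<open>X\<close>.\<close>

lemma finite_quandle_homs:
  assumes X: "finitely_generated_quandle X op" and Y: "quandle Y op'" and "finite Y"
  shows "finite (quandle_hom X op Y op' \<inter> extensional X)"
proof -
  obtain A where A: "finite A" "A \<subseteq> X" "quandle_span X op A = X" and qX: "quandle X op"
    using X by (auto simp: finitely_generated_quandle_def)
  let ?H = "quandle_hom X op Y op' \<inter> extensional X"
  have "(\<lambda>h. restrict h A) ` ?H \<subseteq> A \<rightarrow>\<^sub>E Y"
    using A(2) by (auto simp: quandle_hom_def)
  then have "finite ((\<lambda>h. restrict h A) ` ?H)"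
    using finite_subset finite_PiE[OF A(1)] \<open>finite Y\<close> by meson
  moreover have "inj_on (\<lambda>h. restrict h A) ?H"
  proof (rule inj_onI)
    fix g h assume g: "g \<in> ?H" and h: "h \<in> ?H" and eq: "restrict g A = restrict h A"
    have "g a = h a" if "a \<in> A" for a
      using fun_cong[OF eq, of a] that by simp
    then have "g x = h x" if "x \<in> X" for x
      using quandle_hom_eq_on_span[OF qX Y _ _ A(2), of g h x] g h A(3) that by auto
    then show "g = h" using g h by (intro extensionalityI[of g X h]) auto
  qed
  ultimately show ?thesis by (rule finite_imageD)
qed

lemma hopfian_if_residually_finite:
  fixes X :: "'a set" and op :: "'a \<Rightarrow> 'a \<Rightarrow> 'a"
  assumes X: "finitely_generated_quandle X op"
    and sep: "\<And>x y. \<lbrakk>x \<in> X; y \<in> X; x \<noteq> y\<rbrakk> \<Longrightarrow>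
      \<exists>(Q :: 'q set) op' h. finite Q \<and> quandle Q op' \<and> h \<in> quandle_hom X op Q op' \<and> h x \<noteq> h y"
  shows "hopfian_quandle X op"
  unfolding hopfian_quandle_def
proof (intro conjI ballI impI)
  show qX: "quandle X op" using X by (simp add: finitely_generated_quandle_def)
  interpret quandle X op by fact
  fix f assume f: "f \<in> quandle_hom X op X op" and surj: "f ` X = X"
  show "inj_on f X"
  proof (intro inj_onI, rule ccontr)
    fix x y assume xy: "x \<in> X" "y \<in> X" "f x = f y" "x \<noteq> y"
    obtain Q :: "'q set" and op' h where Q: "finite Q" "quandle Q op'"
      and h: "h \<in> quandle_hom X op Q op'" "h x \<noteq> h y"
      using sep[OF xy(1,2,4)] by blast
    let ?H = "quandle_hom X op Q op' \<inter> extensional X"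
    let ?pre = "\<lambda>k. restrict (k \<circ> f) X"
    have "?pre ` ?H \<subseteq> ?H"
      using f closed by (auto simp: quandle_hom_def Pi_iff)
    \<comment> \<open>Surjectivity of \<open>f\<close> enters here: maps that agree after
      \<open>f\<close> agree on all of \<open>X\<close>.\<close>
    moreover have "inj_on ?pre ?H"
    proof (rule inj_onI)
      fix k l assume k: "k \<in> ?H" and l: "l \<in> ?H" and eq: "?pre k = ?pre l"
      have "k (f z) = l (f z)" if "z \<in> X" for z
        using fun_cong[OF eq, of z] that by simp
      then have "k u = l u" if "u \<in> X" for u
        using that surj by (metis imageE)
      then show "k = l" using k l by (intro extensionalityI[of k X l]) auto
    qed
    ultimately have "?pre ` ?H = ?H"
      using finite_quandle_homs[OF X Q(2,1)] by (intro endo_inj_surj)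
    moreover have "restrict h X \<in> ?H"
      using h(1) closed by (auto simp: quandle_hom_def)
    ultimately obtain k where "restrict h X = ?pre k" by blast
    from fun_cong[OF this, of x] fun_cong[OF this, of y] show False
      using xy h(2) by simp
  qed
qed

section \<open>The quandle of pointed permutations\<close>

text \<open>The condition \<open>c p = p\<close> is what makes \<open>pointed_perm_op\<close>
  idempotent. As \<open>permutes\<close> fixes everything outside \<open>P\<close>, the set is
  finite for finite \<open>P\<close>.\<close>

definition pointed_perms :: "'a set \<Rightarrow> ('a \<times> ('a \<Rightarrow> 'a)) set" where
  "pointed_perms P = {(p, c). p \<in> P \<and> c permutes P \<and> c p = p}"

definition pointed_perm_op ::
    "'a \<times> ('a \<Rightarrow> 'a) \<Rightarrow> 'a \<times> ('a \<Rightarrow> 'a) \<Rightarrow> 'a \<times> ('a \<Rightarrow> 'a)" where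
  "pointed_perm_op u v = (snd v (fst u), snd v \<circ> snd u \<circ> inv (snd v))"

lemma finite_pointed_perms: "finite P \<Longrightarrow> finite (pointed_perms P)"
  by (rule finite_subset[of _ "P \<times> {c. c permutes P}"])
    (auto simp: pointed_perms_def finite_permutations)

lemma pointed_perm_op_closed:
  assumes "u \<in> pointed_perms P" "v \<in> pointed_perms P"
  shows "pointed_perm_op u v \<in> pointed_perms P"
proof -
  have u: "fst u \<in> P" "snd u permutes P" "snd u (fst u) = fst u" and v: "snd v permutes P"
    using assms by (auto simp: pointed_perms_def)
  have "snd v \<circ> snd u \<circ> inv (snd v) permutes P"
    using u(2) v by (intro permutes_compose permutes_inv)
  then show ?thesis
    using u by (simp add: pointed_perms_def pointed_perm_op_def permutes_in_image[OF v]
        permutes_inverses[OF v])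
qed

lemma pointed_perm_op_inverse:
  assumes "u \<in> pointed_perms P" "v \<in> pointed_perms P"
  defines "w \<equiv> (inv (snd v) (fst u), inv (snd v) \<circ> snd u \<circ> snd v)"
  shows "w \<in> pointed_perms P" "pointed_perm_op w v = u"
proof -
  have u: "fst u \<in> P" "snd u permutes P" "snd u (fst u) = fst u" and v: "snd v permutes P"
    using assms by (auto simp: pointed_perms_def)
  have "inv (snd v) \<circ> snd u \<circ> snd v permutes P"
    using u(2) v by (intro permutes_compose permutes_inv)
  then show "w \<in> pointed_perms P"
    using u by (simp add: w_def pointed_perms_def permutes_in_image[OF permutes_inv[OF v]]
        permutes_inverses[OF v])
  show "pointed_perm_op w v = u"
    by (simp add: w_def pointed_perm_op_def prod_eq_iff fun_eq_iff permutes_inverses[OF v])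
qed

lemma pointed_perm_op_cancel:
  assumes "u \<in> pointed_perms P" "w \<in> pointed_perms P" "v \<in> pointed_perms P"
    and "pointed_perm_op u v = pointed_perm_op w v"
  shows "u = w"
proof -
  obtain p c q d r e where uvw: "u = (p, c)" "w = (q, d)" "v = (r, e)"
    by (metis surj_pair)
  have e: "e permutes P" and pq: "e p = e q" and cd: "e \<circ> c \<circ> inv e = e \<circ> d \<circ> inv e"
    using assms by (auto simp: uvw pointed_perms_def pointed_perm_op_def)
  have "c z = d z" for z
    using fun_cong[OF cd, of "e z"] permutes_inverses(2)[OF e] by (metis comp_apply)
  moreover have "p = q" using pq permutes_inverses(2)[OF e] by metis
  ultimately show ?thesis by (auto simp: uvw)
qed

lemma quandle_pointed_perms:
  assumes "P \<noteq> {}"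
  shows "quandle (pointed_perms P) pointed_perm_op"
proof
  obtain p where "p \<in> P" using assms by blast
  then have "(p, id) \<in> pointed_perms P" by (simp add: pointed_perms_def permutes_id)
  then show "pointed_perms P \<noteq> {}" by blast
  show "pointed_perm_op x x = x" if "x \<in> pointed_perms P" for x
    using that by (auto simp: pointed_perms_def pointed_perm_op_def permutes_inverses fun_eq_iff)
  show "\<exists>!z. z \<in> pointed_perms P \<and> x = pointed_perm_op z y"
    if "x \<in> pointed_perms P" "y \<in> pointed_perms P" for x y
    using pointed_perm_op_inverse[OF that] pointed_perm_op_cancel[of _ P _ y] that by metis
  show "pointed_perm_op (pointed_perm_op x y) z
      = pointed_perm_op (pointed_perm_op x z) (pointed_perm_op y z)"
    if "x \<in> pointed_perms P" "y \<in> pointed_perms P" "z \<in> pointed_perms P" for x y z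
  proof -
    have "bij (snd y)" "bij (snd z)" and z: "snd z permutes P"
      using that by (auto simp: pointed_perms_def dest: permutes_bij)
    \<comment> \<open>The permutation of \<open>pointed_perm_op y z\<close> is a conjugate, and its
      inverse is the conjugate of the inverse; the inner factors then cancel.\<close>
    then have "inv (snd z \<circ> snd y \<circ> inv (snd z)) = snd z \<circ> inv (snd y) \<circ> inv (snd z)"
      by (simp add: o_inv_distrib bij_comp bij_imp_bij_inv inv_inv_eq o_assoc)
    then show ?thesis
      by (simp add: pointed_perm_op_def fun_eq_iff permutes_inverses[OF z])
  qed
qed (fact pointed_perm_op_closed)

lemma pointed_perm_inv_op:
  assumes "u \<in> pointed_perms P" "v \<in> pointed_perms P"
  shows "quandle_inv_op (pointed_perms P) pointed_perm_op u v
    = (inv (snd v) (fst u), inv (snd v) \<circ> snd u \<circ> snd v)"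
proof -
  have "P \<noteq> {}" using assms(1) by (auto simp: pointed_perms_def)
  then show ?thesis
    using quandle.inv_op_eqI[OF quandle_pointed_perms pointed_perm_op_inverse(1)[OF assms] assms(2)]
      pointed_perm_op_inverse(2)[OF assms] by blast
qed

text \<open>The complements of \<open>A\<close> and of its image in the finite set \<open>P\<close>
  have equal size, so any bijection between them completes \<open>g\<close>.\<close>

lemma extend_partial_injection:
  assumes P: "finite P" and g: "inj_on g A" and A: "A \<subseteq> P" "g ` A \<subseteq> P"
  obtains c where "c permutes P" "\<And>z. z \<in> A \<Longrightarrow> c z = g z"
proof -
  have "card (P - A) = card (P - g ` A)"
    using P A g by (simp add: card_Diff_subset finite_subset card_image)
  then obtain k where k: "bij_betw k (P - A) (P - g ` A)"
    using P finite_same_card_bij[of "P - A" "P - g ` A"] by auto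
  define c where "c z = (if z \<in> A then g z else if z \<in> P then k z else z)" for z
  have "bij_betw c A (g ` A)"
    using g by (auto simp: bij_betw_def c_def inj_on_def)
  moreover have "bij_betw c (P - A) (P - g ` A)"
    using k by (rule bij_betw_cong[THEN iffD1, rotated]) (auto simp: c_def)
  ultimately have "bij_betw c (A \<union> (P - A)) (g ` A \<union> (P - g ` A))"
    by (rule bij_betw_combine) auto
  moreover have "A \<union> (P - A) = P" "g ` A \<union> (P - g ` A) = P" using A by auto
  ultimately have "c permutes P"
    using A by (intro bij_imp_permutes) (auto simp: c_def)
  then show thesis by (rule that) (simp add: c_def)
qed

section \<open>Free quandles are residually finite\<close>

text \<open>By freeness \<open>\<phi>\<close> extends to a homomorphism \<open>r\<close> into the
  span. Viewed as a map into \<open>F\<close>, it agrees with the identity on the generators, so by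
  uniqueness it is the identity, and all of \<open>F\<close> lies in the span.\<close>

lemma free_quandle_generated:
  assumes free: "is_free_quandle F op S \<phi>"
  shows "quandle_span F op (\<phi> ` S) = F"
proof -
  have S: "S \<noteq> {}" and F: "quandle F op" and phi: "\<phi> \<in> S \<rightarrow> F"
    using free by (auto simp: is_free_quandle_def)
  have U: "quandle_universal TYPE('a) F op S \<phi>"
    using is_free_quandle_universal[OF free] .
  interpret F: quandle F op by fact
  let ?E = "quandle_span F op (\<phi> ` S)"
  have EF: "?E \<subseteq> F"
    using phi F.closed F.inv_op(1) by (intro quandle_span_least) auto
  have phiE: "\<phi> s \<in> ?E" if "s \<in> S" for s
    using that by (auto simp: quandle_span_def)
  have E: "quandle ?E op"
  proof (rule F.subquandle[OF _ EF])
    show "?E \<noteq> {}" using S phiE by blast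
  qed (auto simp: quandle_span_def)
  obtain r where r: "r \<in> quandle_hom F op ?E op" "r \<in> extensional F" "\<forall>s\<in>S. r (\<phi> s) = \<phi> s"
    using U E phiE unfolding quandle_universal_def by blast
  have "r \<in> quandle_hom F op F op" using r(1) EF by (auto simp: quandle_hom_def)
  moreover have "restrict (\<lambda>x. x) F \<in> quandle_hom F op F op"
    using F.closed by (auto simp: quandle_hom_def)
  moreover have "\<forall>s\<in>S. restrict (\<lambda>x. x) F (\<phi> s) = \<phi> s" using phi by auto
  ultimately have "r = restrict (\<lambda>x. x) F"
    using U F phi r(2,3) restrict_extensional unfolding quandle_universal_def by blast
  then have "x \<in> ?E" if "x \<in> F" for x
    using that quandle_homD(1)[OF r(1) that] by simp
  then show ?thesis using EF by blast
qed

lemma ex_partial_action_hom: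
  assumes free: "is_free_quandle F op S \<phi>" and P: "finite P" "P \<noteq> {}" "P \<subseteq> F"
  shows "\<exists>h. h \<in> quandle_hom F op (pointed_perms P) pointed_perm_op \<and>
    (\<forall>s\<in>S. \<phi> s \<in> P \<longrightarrow> fst (h (\<phi> s)) = \<phi> s \<and>
      (\<forall>z\<in>P. op z (\<phi> s) \<in> P \<longrightarrow> snd (h (\<phi> s)) z = op z (\<phi> s)))"
proof -
  interpret F: quandle F op using free by (simp add: is_free_quandle_def)
  have phi: "\<phi> s \<in> F" if "s \<in> S" for s
    using free that by (auto simp: is_free_quandle_def)
  obtain p where p: "p \<in> P" using P by blast
  have "\<exists>c. c permutes P \<and> (\<forall>z\<in>P. op z (\<phi> s) \<in> P \<longrightarrow> c z = op z (\<phi> s))" if "s \<in> S" for s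
  proof -
    let ?A = "{z \<in> P. op z (\<phi> s) \<in> P}"
    have "inj_on (\<lambda>z. op z (\<phi> s)) ?A"
      using F.op_right_cancel phi[OF that] P(3) by (intro inj_onI) blast
    then obtain c where "c permutes P" "\<And>z. z \<in> ?A \<Longrightarrow> c z = op z (\<phi> s)"
      by (rule extend_partial_injection[OF P(1)]) auto
    then show ?thesis by blast
  qed
  then obtain c where c: "\<And>s. s \<in> S \<Longrightarrow> c s permutes P"
    "\<And>s z. \<lbrakk>s \<in> S; z \<in> P; op z (\<phi> s) \<in> P\<rbrakk> \<Longrightarrow> c s z = op z (\<phi> s)"
    by metis
  \<comment> \<open>Generators outside \<open>P\<close> get the default \<open>(p, id)\<close>. For
    the others, \<open>op (\<phi> s) (\<phi> s) = \<phi> s\<close> lies in \<open>P\<close>, so the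
    extension \<open>c s\<close> fixes \<open>\<phi> s\<close>.\<close>
  define \<rho> where "\<rho> s = (if \<phi> s \<in> P then (\<phi> s, c s) else (p, id))" for s
  have "\<rho> s \<in> pointed_perms P" if "s \<in> S" for s
    using that c(1)[OF that] c(2)[OF that, of "\<phi> s"] F.idem[OF phi[OF that]] p permutes_id[of P]
    by (auto simp: \<rho>_def pointed_perms_def)
  then obtain h where "h \<in> quandle_hom F op (pointed_perms P) pointed_perm_op"
    "\<forall>s\<in>S. h (\<phi> s) = \<rho> s"
    using is_free_quandle_universal[OF free] quandle_pointed_perms[OF P(2)]
    unfolding quandle_universal_def by (metis (no_types, lifting) Pi_I)
  then show ?thesis using c(2) by (intro exI[of _ h]) (auto simp: \<rho>_def)
qed

lemma free_quandle_residually_finite: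
  fixes F :: "'a set" and op :: "'a \<Rightarrow> 'a \<Rightarrow> 'a"
  assumes free: "is_free_quandle F op S \<phi>" and xy: "x \<in> F" "y \<in> F" "x \<noteq> y"
  shows "\<exists>(Q :: ('a \<times> ('a \<Rightarrow> 'a)) set) op' h.
    finite Q \<and> quandle Q op' \<and> h \<in> quandle_hom F op Q op' \<and> h x \<noteq> h y"
proof -
  have F: "quandle F op" and phi: "\<And>s. s \<in> S \<Longrightarrow> \<phi> s \<in> F"
    using free by (auto simp: is_free_quandle_def)
  interpret F: quandle F op by fact
  let ?inv = "quandle_inv_op F op"
  define adm where "adm P \<longleftrightarrow> finite P \<and> P \<noteq> {} \<and> P \<subseteq> F" for P
  define good where "good P h \<longleftrightarrow> h \<in> quandle_hom F op (pointed_perms P) pointed_perm_op \<and>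
    (\<forall>s\<in>S. \<phi> s \<in> P \<longrightarrow> fst (h (\<phi> s)) = \<phi> s \<and>
      (\<forall>z\<in>P. op z (\<phi> s) \<in> P \<longrightarrow> snd (h (\<phi> s)) z = op z (\<phi> s)))" for P h
  have "\<exists>h. good P h" if "adm P" for P
    using ex_partial_action_hom[OF free] that by (simp add: adm_def good_def)
  \<comment> \<open>One homomorphism is fixed for each \<open>P\<close>, so that statements about
    different elements of \<open>F\<close> concern the same one.\<close>
  then obtain H where good: "\<And>P. adm P \<Longrightarrow> good P (H P)"
    by metis
  then have H: "\<And>P. adm P \<Longrightarrow> H P \<in> quandle_hom F op (pointed_perms P) pointed_perm_op"
    and Hphi: "\<And>P s. \<lbrakk>adm P; s \<in> S; \<phi> s \<in> P\<rbrakk> \<Longrightarrow> fst (H P (\<phi> s)) = \<phi> s"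
      "\<And>P s z. \<lbrakk>adm P; s \<in> S; \<phi> s \<in> P; z \<in> P; op z (\<phi> s) \<in> P\<rbrakk>
        \<Longrightarrow> snd (H P (\<phi> s)) z = op z (\<phi> s)"
    by (simp_all add: good_def)
  have HP: "H P a \<in> pointed_perms P" if "adm P" "a \<in> F" for P a
    using quandle_homD(1)[OF H[OF that(1)] that(2)] .
  then have perm: "snd (H P a) permutes P" if "adm P" "a \<in> F" for P a
    using that by (fastforce simp: pointed_perms_def)
  \<comment> \<open>This filter expresses "for all large enough finite \<open>P\<close>"; finitely
    many such requirements hold together.\<close>
  let ?ev = "\<lambda>R. eventually R (finite_subsets_at_top F)"
  have ev_subset: "?ev (\<lambda>P. adm P \<and> A \<subseteq> P)" if "finite A" "A \<subseteq> F" for A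
    unfolding eventually_finite_subsets_at_top
    \<comment> \<open>Inserting \<open>x\<close> keeps the set nonempty, as \<open>adm\<close>
      requires, when \<open>A\<close> is empty.\<close>
    using that xy by (intro exI[of _ "insert x A"]) (auto simp: adm_def)
  have ev_adm: "?ev adm"
    using ev_subset[of "{}"] by simp
  \<comment> \<open>The permutations are part of the invariant because the operation of the target applies
    the permutation of its right argument.\<close>
  define E where "E = {a \<in> F. ?ev (\<lambda>P. fst (H P a) = a) \<and>
    (\<forall>z\<in>F. ?ev (\<lambda>P. snd (H P a) z = op z a) \<and> ?ev (\<lambda>P. inv (snd (H P a)) z = ?inv z a))}"
  have Efst: "?ev (\<lambda>P. fst (H P a) = a)" if "a \<in> E" for a
    using that by (simp add: E_def)
  have Esnd: "?ev (\<lambda>P. snd (H P a) z = op z a)" if "a \<in> E" "z \<in> F" for a z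
    using that by (simp add: E_def)
  have Einv: "?ev (\<lambda>P. inv (snd (H P a)) z = ?inv z a)" if "a \<in> E" "z \<in> F" for a z
    using that by (simp add: E_def)
  have "quandle_span F op (\<phi> ` S) \<subseteq> E"
  proof (rule quandle_span_least)
    show "E \<subseteq> F" by (auto simp: E_def)
    show "\<phi> ` S \<subseteq> E"
    proof clarify
      fix s assume s: "s \<in> S"
      have s': "\<phi> s \<in> F" using phi[OF s] .
      have "?ev (\<lambda>P. fst (H P (\<phi> s)) = \<phi> s)"
        by (rule eventually_mono[OF ev_subset[of "{\<phi> s}"]]) (auto simp: Hphi s s')
      moreover have "?ev (\<lambda>P. snd (H P (\<phi> s)) z = op z (\<phi> s))" if "z \<in> F" for z
      proof -
        \<comment> \<open>Once \<open>P\<close> contains these points, \<open>z\<close> is in the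
          domain of the partial translation, where the permutation is prescribed.\<close>
        have "?ev (\<lambda>P. adm P \<and> {\<phi> s, z, op z (\<phi> s)} \<subseteq> P)"
          using that s' F.closed by (intro ev_subset) auto
        then show ?thesis by eventually_elim (auto simp: Hphi s)
      qed
      moreover have "?ev (\<lambda>P. inv (snd (H P (\<phi> s))) z = ?inv z (\<phi> s))" if z: "z \<in> F" for z
      proof -
        have "?ev (\<lambda>P. adm P \<and> {\<phi> s, z, ?inv z (\<phi> s)} \<subseteq> P)"
          using z s' F.inv_op by (intro ev_subset) auto
        then show ?thesis
        proof eventually_elim
          case (elim P)
          then have "snd (H P (\<phi> s)) (?inv z (\<phi> s)) = z"
            using Hphi(2)[of P s "?inv z (\<phi> s)"] s F.inv_op(2)[OF z s'] by simp
          then show ?case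
            using permutes_inv_eq[OF perm[of P "\<phi> s"]] elim s' by simp
        qed
      qed
      ultimately show "\<phi> s \<in> E" using s' by (simp add: E_def)
    qed
  next
    fix a b assume a: "a \<in> E" and b: "b \<in> E"
    then have aF: "a \<in> F" and bF: "b \<in> F" by (auto simp: E_def)
    have invF: "?inv u v \<in> F" if "u \<in> F" "v \<in> F" for u v using F.inv_op(1) that .
    show "op a b \<in> E"
    proof -
      have eq: "?ev (\<lambda>P. H P (op a b) = pointed_perm_op (H P a) (H P b))"
        using ev_adm by eventually_elim (use quandle_homD(2)[OF H] aF bF in simp)
      have "?ev (\<lambda>P. fst (H P (op a b)) = op a b)"
        using eq Efst[OF a] Esnd[OF b aF]
        by eventually_elim (simp add: pointed_perm_op_def)
      \<comment> \<open>The conjugate sends \<open>z\<close> to \<open>?inv z b\<close>, then acts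
        by \<open>a\<close> and by \<open>b\<close>; each of the three steps is eventually
        correct.\<close>
      moreover have "?ev (\<lambda>P. snd (H P (op a b)) z = op z (op a b))" if z: "z \<in> F" for z
        using eq Einv[OF b z] Esnd[OF a invF[OF z bF]] Esnd[OF b F.closed[OF invF[OF z bF] aF]]
      proof eventually_elim
        case (elim P)
        have "op (op (?inv z b) a) b = op z (op a b)"
          using F.distrib[OF invF[OF z bF] aF bF] F.inv_op(2)[OF z bF] by simp
        then show ?case using elim by (simp add: pointed_perm_op_def)
      qed
      moreover have "?ev (\<lambda>P. inv (snd (H P (op a b))) z = ?inv z (op a b))" if z: "z \<in> F" for z
      proof -
        \<comment> \<open>The inverse of the conjugate divides \<open>z\<close> by \<open>b\<close>
          and by \<open>a\<close>, which gives \<open>?w\<close>, and then multiplies by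
          \<open>b\<close>; hence the value \<open>op ?w b\<close>.\<close>
        let ?w = "?inv (?inv z b) a"
        have wF: "?w \<in> F" using invF z aF bF by blast
        show ?thesis
          using eq ev_adm Einv[OF b z] Einv[OF a invF[OF z bF]] Esnd[OF b wF]
        proof eventually_elim
          case (elim P)
          have "op (op ?w b) (op a b) = z"
            using F.distrib[OF wF aF bF] F.inv_op(2) invF z aF bF by simp
          then have "?inv z (op a b) = op ?w b"
            using wF aF bF F.closed by (intro F.inv_op_eqI) auto
          moreover have "snd (H P (op a b)) (op ?w b) = z"
            using elim permutes_inverses[OF perm[OF elim(2) aF]]
              permutes_inverses[OF perm[OF elim(2) bF]]
            by (simp add: pointed_perm_op_def) metis
          ultimately show ?case
            using permutes_inv_eq[OF perm[OF elim(2) F.closed[OF aF bF]]] by simp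
        qed
      qed
      ultimately show ?thesis using F.closed[OF aF bF] by (simp add: E_def)
    qed
    show "?inv a b \<in> E"
    proof -
      let ?c = "?inv a b"
      have cF: "?c \<in> F" using invF aF bF .
      \<comment> \<open>As \<open>op ?c b = a\<close>, right translation by \<open>?c\<close> is
        that by \<open>a\<close> conjugated by that by \<open>b\<close>, matching the form of
        \<open>H P ?c\<close> below.\<close>
      have act: "op (op z ?c) b = op (op z b) a" if "z \<in> F" for z
        using F.distrib[OF that cF bF] F.inv_op(2)[OF aF bF] by simp
      have eq: "?ev (\<lambda>P. H P ?c = (inv (snd (H P b)) (fst (H P a)),
          inv (snd (H P b)) \<circ> snd (H P a) \<circ> snd (H P b)))"
        using ev_adm
      proof eventually_elim
        case (elim P)
        have "quandle (pointed_perms P) pointed_perm_op"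
          using elim by (intro quandle_pointed_perms) (simp add: adm_def)
        then show ?case
          using quandle_hom_inv_op[OF F _ H[OF elim] aF bF]
            pointed_perm_inv_op[OF HP[OF elim aF] HP[OF elim bF]] by simp
      qed
      have "?ev (\<lambda>P. fst (H P ?c) = ?c)"
        using eq Efst[OF a] Einv[OF b aF] by eventually_elim simp
      moreover have "?ev (\<lambda>P. snd (H P ?c) z = op z ?c)" if z: "z \<in> F" for z
      proof -
        have zb: "op z b \<in> F" using F.closed z bF .
        show ?thesis
          using eq Esnd[OF b z] Esnd[OF a zb] Einv[OF b F.closed[OF zb aF]]
        proof eventually_elim
          case (elim P)
          have "?inv (op (op z b) a) b = op z ?c"
            using act[OF z] F.closed[OF z cF] bF by (intro F.inv_op_eqI) auto
          then show ?case using elim by simp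
        qed
      qed
      moreover have "?ev (\<lambda>P. inv (snd (H P ?c)) z = ?inv z ?c)" if z: "z \<in> F" for z
      proof -
        \<comment> \<open>The inverse of this conjugate sends \<open>z\<close> to
          \<open>op z b\<close>, then to \<open>?v\<close>, then to \<open>?inv ?v b\<close>, which
          has to be \<open>?inv z ?c\<close>.\<close>
        let ?v = "?inv (op z b) a"
        have zb: "op z b \<in> F" using F.closed z bF .
        have vF: "?v \<in> F" using invF[OF zb aF] .
        show ?thesis
          using eq ev_adm Esnd[OF b z] Einv[OF a zb] Einv[OF b vF]
        proof eventually_elim
          case (elim P)
          let ?w = "?inv ?v b"
          have wF: "?w \<in> F" using invF[OF vF bF] .
          have "op (op ?w ?c) b = op z b"
            using act[OF wF] F.inv_op(2)[OF vF bF] F.inv_op(2)[OF zb aF] by simp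
          then have "op ?w ?c = z"
            using F.op_right_cancel[OF F.closed[OF wF cF] z bF] by simp
          then have "?inv z ?c = ?w"
            using wF cF by (intro F.inv_op_eqI) auto
          moreover have "snd (H P ?c) ?w = z"
            using elim permutes_inverses[OF perm[OF elim(2) aF]]
              permutes_inverses[OF perm[OF elim(2) bF]]
            by simp metis
          ultimately show ?case
            using permutes_inv_eq[OF perm[OF elim(2) cF]] by simp
        qed
      qed
      ultimately show ?thesis using cF by (simp add: E_def)
    qed
  qed
  \<comment> \<open>Both \<open>x\<close> and \<open>y\<close> lie in the span, hence in
    \<open>E\<close>, so a single \<open>P\<close> serves both, and first components already
    separate them.\<close>
  then have "?ev (\<lambda>P. adm P \<and> fst (H P x) = x \<and> fst (H P y) = y)"
    using ev_adm Efst xy free_quandle_generated[OF free] by (intro eventually_conj) auto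
  then obtain P where P: "adm P" "fst (H P x) = x" "fst (H P y) = y"
    unfolding eventually_finite_subsets_at_top by blast
  have "finite (pointed_perms P)" "quandle (pointed_perms P) pointed_perm_op"
    using P(1) finite_pointed_perms[of P] quandle_pointed_perms[of P] by (simp_all add: adm_def)
  moreover have "H P x \<noteq> H P y" using P(2,3) xy(3) by auto
  ultimately show ?thesis using H[OF P(1)] by blast
qed

theorem corollary5p8:
  fixes F :: "'a set" and op :: "'a \<Rightarrow> 'a \<Rightarrow> 'a" and S :: "'s set" and \<phi> :: "'s \<Rightarrow> 'a"
  assumes "is_free_quandle F op S \<phi>"
    and "finitely_generated_quandle F op"
  shows "hopfian_quandle F op"
  by (rule hopfian_if_residually_finite[OF assms(2) free_quandle_residually_finite[OF assms(1)]])

end
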